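(* Let $\mathbf{C}$ be a category with an initial object, let $S,T$ be monads on $\mathbf{C}$, and let $\delta\colon TS\to ST$ be a monad distributive law with $T$ constant-free. Then the monad morphism $S\eta^T\colon S\to ST$, where $ST$ carries the composite monad structure induced by $\delta$, is admissible.
   Context: A monad distributive law (Beck) $\delta\colon TS\to ST$ is a natural transformation commuting with the units and multiplications of both $S$ and $T$; it makes $ST$ a monad, and $S\eta^T\colon S\to ST$ a monad morphism. A monad $T$ on a category with initial object $\emptyset$ is constant-free iff $\eta^T_\emptyset\colon\emptyset\to T\emptyset$ is an isomorphism. A monad morphism $\alpha\colon R\to R'$ is admissible iff $\alpha_\emptyset\colon R\emptyset\to R'\emptyset$ is an isomorphism. *)

theory Defs
  imports Main
begin

text \<open>
  Categories have explicit sets of objects and arrows. All operations are total HOL functions; they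
  are constrained only on these sets, on composable pairs \<open>g \<cdot> f\<close> (first \<open>f\<close>, then \<open>g\<close>).
  Functors and natural transformations are likewise only constrained on objects and arrows, so all
  diagrams below are stated componentwise at objects rather than as equations of functions.
\<close>

record ('o, 'a) cat_data =
  Obj :: "'o set"
  Arr :: "'a set"
  src :: "'a \<Rightarrow> 'o"
  tgt :: "'a \<Rightarrow> 'o"
  idn :: "'o \<Rightarrow> 'a"
  cmp :: "'a \<Rightarrow> 'a \<Rightarrow> 'a"  (infixr "\<cdot>\<index>" 70)

definition hom :: "('o, 'a, 'm) cat_data_scheme \<Rightarrow> 'o \<Rightarrow> 'o \<Rightarrow> 'a set" where
  "hom C x y = {f \<in> Arr C. src C f = x \<and> tgt C f = y}"

locale category =
  fixes C :: "('o, 'a, 'm) cat_data_scheme" (structure)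
  assumes src_Obj: "f \<in> Arr C \<Longrightarrow> src C f \<in> Obj C"
    and tgt_Obj: "f \<in> Arr C \<Longrightarrow> tgt C f \<in> Obj C"
    and idn_hom: "x \<in> Obj C \<Longrightarrow> idn C x \<in> hom C x x"
    and cmp_hom: "\<lbrakk>f \<in> hom C x y; g \<in> hom C y z\<rbrakk> \<Longrightarrow> g \<cdot> f \<in> hom C x z"
    and cmp_idn: "f \<in> hom C x y \<Longrightarrow> f \<cdot> idn C x = f"
    and idn_cmp: "f \<in> hom C x y \<Longrightarrow> idn C y \<cdot> f = f"
    and cmp_assoc: "\<lbrakk>f \<in> hom C w x; g \<in> hom C x y; h \<in> hom C y z\<rbrakk>
                      \<Longrightarrow> (h \<cdot> g) \<cdot> f = h \<cdot> (g \<cdot> f)"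

definition initial_object :: "('o, 'a, 'm) cat_data_scheme \<Rightarrow> 'o \<Rightarrow> bool" where
  "initial_object C z \<longleftrightarrow> z \<in> Obj C \<and> (\<forall>x\<in>Obj C. \<exists>!f. f \<in> hom C z x)"

definition isomorphism :: "('o, 'a, 'm) cat_data_scheme \<Rightarrow> 'a \<Rightarrow> bool" where
  "isomorphism C f \<longleftrightarrow>
     f \<in> Arr C \<and>
     (\<exists>g \<in> hom C (tgt C f) (src C f).
        g \<cdot>\<^bsub>C\<^esub> f = idn C (src C f) \<and> f \<cdot>\<^bsub>C\<^esub> g = idn C (tgt C f))"


record ('o, 'a) functor_data =
  omap :: "'o \<Rightarrow> 'o"
  fmap :: "'a \<Rightarrow> 'a"

locale endofunctor = category C
  for C :: "('o, 'a, 'm) cat_data_scheme" (structure) +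
  fixes F :: "('o, 'a, 'n) functor_data_scheme"
  assumes omap_Obj: "x \<in> Obj C \<Longrightarrow> omap F x \<in> Obj C"
    and fmap_hom: "f \<in> hom C x y \<Longrightarrow> fmap F f \<in> hom C (omap F x) (omap F y)"
    and fmap_idn: "x \<in> Obj C \<Longrightarrow> fmap F (idn C x) = idn C (omap F x)"
    and fmap_cmp: "\<lbrakk>f \<in> hom C x y; g \<in> hom C y z\<rbrakk> \<Longrightarrow> fmap F (g \<cdot> f) = fmap F g \<cdot> fmap F f"

definition id_functor :: "('o, 'a) functor_data" where
  "id_functor = \<lparr>omap = (\<lambda>x. x), fmap = (\<lambda>f. f)\<rparr>"

definition comp_functor ::
  "('o, 'a, 'm) functor_data_scheme \<Rightarrow> ('o, 'a, 'n) functor_data_scheme \<Rightarrow> ('o, 'a) functor_data"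
  (infixr "\<odot>" 70) where
  "G \<odot> F = \<lparr>omap = (\<lambda>x. omap G (omap F x)), fmap = (\<lambda>f. fmap G (fmap F f))\<rparr>"

locale nat_trans = F: endofunctor C F + G: endofunctor C G
  for C :: "('o, 'a, 'm) cat_data_scheme" (structure)
    and F :: "('o, 'a, 'n) functor_data_scheme"
    and G :: "('o, 'a, 'k) functor_data_scheme" +
  fixes \<alpha> :: "'o \<Rightarrow> 'a"
  assumes component_hom: "x \<in> Obj C \<Longrightarrow> \<alpha> x \<in> hom C (omap F x) (omap G x)"
    and naturality: "f \<in> hom C x y \<Longrightarrow> \<alpha> y \<cdot> fmap F f = fmap G f \<cdot> \<alpha> x"

definition whisker_left ::
  "('o, 'a, 'n) functor_data_scheme \<Rightarrow> ('o \<Rightarrow> 'a) \<Rightarrow> ('o \<Rightarrow> 'a)" where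
  "whisker_left F \<alpha> = (\<lambda>x. fmap F (\<alpha> x))"


record ('o, 'a) monad_data = "('o, 'a) functor_data" +
  unit :: "'o \<Rightarrow> 'a"
  mult :: "'o \<Rightarrow> 'a"

locale monad = category C
  for C :: "('o, 'a, 'm) cat_data_scheme" (structure) +
  fixes T :: "('o, 'a, 'n) monad_data_scheme"
  assumes unit_nat: "nat_trans C id_functor T (unit T)"
    and mult_nat: "nat_trans C (T \<odot> T) T (mult T)"
    and unit_left: "x \<in> Obj C \<Longrightarrow> mult T x \<cdot> unit T (omap T x) = idn C (omap T x)"
    and unit_right: "x \<in> Obj C \<Longrightarrow> mult T x \<cdot> fmap T (unit T x) = idn C (omap T x)"
    and mult_assoc: "x \<in> Obj C \<Longrightarrow>
      mult T x \<cdot> mult T (omap T x) = mult T x \<cdot> fmap T (mult T x)"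

locale monad_morphism = R: monad C R + R': monad C R'
  for C :: "('o, 'a, 'm) cat_data_scheme" (structure)
    and R :: "('o, 'a, 'n) monad_data_scheme"
    and R' :: "('o, 'a, 'k) monad_data_scheme" +
  fixes \<alpha> :: "'o \<Rightarrow> 'a"
  assumes nat: "nat_trans C R R' \<alpha>"
    and preserves_unit: "x \<in> Obj C \<Longrightarrow> \<alpha> x \<cdot> unit R x = unit R' x"
    and preserves_mult: "x \<in> Obj C \<Longrightarrow>
      \<alpha> x \<cdot> mult R x = mult R' x \<cdot> \<alpha> (omap R' x) \<cdot> fmap R (\<alpha> x)"

locale distributive_law = S: monad C S + T: monad C T
  for C :: "('o, 'a, 'm) cat_data_scheme" (structure)
    and S :: "('o, 'a, 'n) monad_data_scheme"
    and T :: "('o, 'a, 'k) monad_data_scheme" +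
  fixes \<delta> :: "'o \<Rightarrow> 'a"
  assumes nat: "nat_trans C (T \<odot> S) (S \<odot> T) \<delta>"
    and unit_T: "x \<in> Obj C \<Longrightarrow> \<delta> x \<cdot> unit T (omap S x) = fmap S (unit T x)"
    and unit_S: "x \<in> Obj C \<Longrightarrow> \<delta> x \<cdot> fmap T (unit S x) = unit S (omap T x)"
    and mult_T: "x \<in> Obj C \<Longrightarrow>
      \<delta> x \<cdot> mult T (omap S x) = fmap S (mult T x) \<cdot> \<delta> (omap T x) \<cdot> fmap T (\<delta> x)"
    and mult_S: "x \<in> Obj C \<Longrightarrow>
      \<delta> x \<cdot> fmap T (mult S x) = mult S (omap T x) \<cdot> fmap S (\<delta> x) \<cdot> \<delta> (omap S x)"

text \<open>
  The multiplication of \<open>ST\<close> is the composite \<open>STST \<rightarrow> SSTT \<rightarrow> SST \<rightarrow> ST\<close> of \<open>S\<delta>T\<close>, \<open>SS\<mu>\<^sup>T\<close>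
  and \<open>\<mu>\<^sup>ST\<close>.
\<close>

definition composite_monad ::
  "('o, 'a, 'm) cat_data_scheme \<Rightarrow> ('o, 'a, 'n) monad_data_scheme \<Rightarrow>
   ('o, 'a, 'k) monad_data_scheme \<Rightarrow> ('o \<Rightarrow> 'a) \<Rightarrow> ('o, 'a) monad_data" where
  "composite_monad C S T \<delta> =
     \<lparr>omap = omap (S \<odot> T), fmap = fmap (S \<odot> T),
      unit = (\<lambda>x. unit S (omap T x) \<cdot>\<^bsub>C\<^esub> unit T x),
      mult = (\<lambda>x. mult S (omap T x) \<cdot>\<^bsub>C\<^esub> fmap S (fmap S (mult T x)) \<cdot>\<^bsub>C\<^esub> fmap S (\<delta> (omap T x)))\<rparr>"

text \<open>The next two notions are relative to a chosen initial object \<open>z\<close>.\<close>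

definition constant_free ::
  "('o, 'a, 'm) cat_data_scheme \<Rightarrow> 'o \<Rightarrow> ('o, 'a, 'n) monad_data_scheme \<Rightarrow> bool" where
  "constant_free C z T \<longleftrightarrow> initial_object C z \<and> monad C T \<and> isomorphism C (unit T z)"

definition admissible ::
  "('o, 'a, 'm) cat_data_scheme \<Rightarrow> 'o \<Rightarrow> ('o, 'a, 'n) monad_data_scheme \<Rightarrow>
   ('o, 'a, 'k) monad_data_scheme \<Rightarrow> ('o \<Rightarrow> 'a) \<Rightarrow> bool" where
  "admissible C z R R' \<alpha> \<longleftrightarrow>
     initial_object C z \<and> monad_morphism C R R' \<alpha> \<and> isomorphism C (\<alpha> z)"

end

theory Submission
  imports Defs
begin

text \<open>
  A functor preserves isomorphisms, so \<open>S\<eta>\<^sup>T\<close> at the initial object is invertible as soon as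
  \<open>\<eta>\<^sup>T\<close> is. The remaining work is Beck's theorem that \<open>ST\<close> is a monad and \<open>S\<eta>\<^sup>T\<close> a monad morphism.
  Its equations are proved by rewriting: naturality moves functor images to the left of \<open>\<mu>\<close> and
  \<open>\<delta>\<close>, to the right of \<open>\<eta>\<close>, and the monad and distributive laws remove what is left.
\<close>

context category
begin

lemma idn_Arr [simp]: "x \<in> Obj C \<Longrightarrow> idn C x \<in> Arr C"
  and src_idn [simp]: "x \<in> Obj C \<Longrightarrow> src C (idn C x) = x"
  and tgt_idn [simp]: "x \<in> Obj C \<Longrightarrow> tgt C (idn C x) = x"
  using idn_hom by (auto simp: hom_def)

lemma cmp_Arr [simp]: "\<lbrakk>f \<in> Arr C; g \<in> Arr C; src C g = tgt C f\<rbrakk> \<Longrightarrow> g \<cdot> f \<in> Arr C"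
  and src_cmp [simp]: "\<lbrakk>f \<in> Arr C; g \<in> Arr C; src C g = tgt C f\<rbrakk> \<Longrightarrow> src C (g \<cdot> f) = src C f"
  and tgt_cmp [simp]: "\<lbrakk>f \<in> Arr C; g \<in> Arr C; src C g = tgt C f\<rbrakk> \<Longrightarrow> tgt C (g \<cdot> f) = tgt C g"
  using cmp_hom[of f "src C f" "tgt C f" g "tgt C g"] by (auto simp: hom_def)

lemma cmp_idn_right [simp]: "\<lbrakk>f \<in> Arr C; src C f = x\<rbrakk> \<Longrightarrow> f \<cdot> idn C x = f"
  and cmp_idn_left [simp]: "\<lbrakk>f \<in> Arr C; tgt C f = x\<rbrakk> \<Longrightarrow> idn C x \<cdot> f = f"
  using cmp_idn idn_cmp by (auto simp: hom_def)

lemma cmp_cmp [simp]: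
  "\<lbrakk>f \<in> Arr C; g \<in> Arr C; h \<in> Arr C; src C g = tgt C f; src C h = tgt C g\<rbrakk>
    \<Longrightarrow> (h \<cdot> g) \<cdot> f = h \<cdot> (g \<cdot> f)"
  by (rule cmp_assoc) (auto simp: hom_def)

declare src_Obj [simp] tgt_Obj [simp]

text \<open>Composites are normalised to nest to the right, which hides the redex
  \<open>a \<cdot> b\<close> when an arrow \<open>h\<close> precedes it. Applied with
  \<open>THEN\<close>, this gives each law a variant that matches there.\<close>

lemma cmp_eq_cmp:
  assumes "a \<cdot> b = c" "a \<in> Arr C" "b \<in> Arr C" "src C a = tgt C b" "h \<in> Arr C" "src C b = tgt C h"
  shows "a \<cdot> (b \<cdot> h) = c \<cdot> h"
  using assms cmp_cmp[of h b a] by simp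

lemma endofunctor_id_functor: "endofunctor C id_functor"
  by unfold_locales (auto simp: id_functor_def)

end

context endofunctor
begin

declare omap_Obj [simp] fmap_idn [simp]

lemma fmap_Arr [simp]: "f \<in> Arr C \<Longrightarrow> fmap F f \<in> Arr C"
  and src_fmap [simp]: "f \<in> Arr C \<Longrightarrow> src C (fmap F f) = omap F (src C f)"
  and tgt_fmap [simp]: "f \<in> Arr C \<Longrightarrow> tgt C (fmap F f) = omap F (tgt C f)"
  using fmap_hom[of f "src C f" "tgt C f"] by (auto simp: hom_def)

lemma fmap_cmp_Arr [simp]:
  "\<lbrakk>f \<in> Arr C; g \<in> Arr C; src C g = tgt C f\<rbrakk> \<Longrightarrow> fmap F (g \<cdot> f) = fmap F g \<cdot> fmap F f"
  by (rule fmap_cmp) (auto simp: hom_def)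

text \<open>Plays the same role under a functor: \<open>fmap_cmp_Arr\<close> splits
  \<open>fmap F (a \<cdot> b)\<close>, so a law must be restated for the split form.\<close>

lemma fmap_eq_cmp:
  assumes "a \<cdot> b = c" "a \<in> Arr C" "b \<in> Arr C" "src C a = tgt C b"
  shows "fmap F a \<cdot> fmap F b = fmap F c"
  using assms fmap_cmp_Arr[of b a] by simp

lemma isomorphism_fmap:
  assumes "isomorphism C f"
  shows "isomorphism C (fmap F f)"
proof -
  obtain g where f: "f \<in> Arr C" and g: "g \<in> Arr C" "src C g = tgt C f" "tgt C g = src C f"
    and eqs: "g \<cdot> f = idn C (src C f)" "f \<cdot> g = idn C (tgt C f)"
    using assms by (auto simp: isomorphism_def hom_def)
  \<comment> \<open>Functoriality is used from right to left here, so that the composite of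
    \<open>f\<close> and \<open>g\<close> reappears under \<open>F\<close> and \<open>eqs\<close>
    applies.\<close>
  have "fmap F g \<cdot> fmap F f = idn C (omap F (src C f))"
    "fmap F f \<cdot> fmap F g = idn C (omap F (tgt C f))"
    using f g eqs by (simp_all flip: fmap_cmp_Arr)
  then show ?thesis
    using f g unfolding isomorphism_def hom_def by (intro conjI bexI[of _ "fmap F g"]) simp_all
qed

end

lemma endofunctor_comp_functor:
  fixes C :: "('o, 'a, 'm) cat_data_scheme"
  assumes "endofunctor C G" "endofunctor C F"
  shows "endofunctor C (G \<odot> F)"
proof -
  interpret G: endofunctor C G by fact
  interpret F: endofunctor C F by fact
  show ?thesis
    by unfold_locales (auto simp: comp_functor_def hom_def)
qed

lemma nat_transI:
  fixes C :: "('o, 'a, 'm) cat_data_scheme" (structure)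
  assumes "endofunctor C F" "endofunctor C G"
    and "\<And>x. x \<in> Obj C \<Longrightarrow> \<alpha> x \<in> Arr C"
    and "\<And>x. x \<in> Obj C \<Longrightarrow> src C (\<alpha> x) = omap F x"
    and "\<And>x. x \<in> Obj C \<Longrightarrow> tgt C (\<alpha> x) = omap G x"
    and "\<And>f. f \<in> Arr C \<Longrightarrow> \<alpha> (tgt C f) \<cdot> fmap F f = fmap G f \<cdot> \<alpha> (src C f)"
  shows "nat_trans C F G \<alpha>"
  using assms by (intro nat_trans.intro nat_trans_axioms.intro) (auto simp: hom_def)

context monad
begin

text \<open>Functoriality of \<open>T\<close> is contained in the naturality of its unit, whose
  codomain functor is \<open>T\<close>.\<close>

sublocale endofunctor C T
  using unit_nat by (rule nat_trans.axioms(2))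

lemma unit_Arr [simp]: "x \<in> Obj C \<Longrightarrow> unit T x \<in> Arr C"
  and src_unit [simp]: "x \<in> Obj C \<Longrightarrow> src C (unit T x) = x"
  and tgt_unit [simp]: "x \<in> Obj C \<Longrightarrow> tgt C (unit T x) = omap T x"
  using nat_trans.component_hom[OF unit_nat] by (auto simp: hom_def id_functor_def)

lemma mult_Arr [simp]: "x \<in> Obj C \<Longrightarrow> mult T x \<in> Arr C"
  and src_mult [simp]: "x \<in> Obj C \<Longrightarrow> src C (mult T x) = omap T (omap T x)"
  and tgt_mult [simp]: "x \<in> Obj C \<Longrightarrow> tgt C (mult T x) = omap T x"
  using nat_trans.component_hom[OF mult_nat] by (auto simp: hom_def comp_functor_def)

text \<open>The premise \<open>src C f = x\<close> leaves \<open>x\<close> free in the pattern, so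
  the rule matches objects in any syntactic form.\<close>

lemma unit_natural:
  "\<lbrakk>f \<in> Arr C; src C f = x\<rbrakk> \<Longrightarrow> fmap T f \<cdot> unit T x = unit T (tgt C f) \<cdot> f"
  using nat_trans.naturality[OF unit_nat, of f x "tgt C f"] by (auto simp: hom_def id_functor_def)

lemma mult_natural:
  "\<lbrakk>f \<in> Arr C; tgt C f = y\<rbrakk> \<Longrightarrow> mult T y \<cdot> fmap T (fmap T f) = fmap T f \<cdot> mult T (src C f)"
  using nat_trans.naturality[OF mult_nat, of f "src C f" y] by (auto simp: hom_def comp_functor_def)

lemmas monad_rules =
  unit_left unit_right mult_assoc [symmetric] unit_natural mult_natural

lemmas monad_rules_cmp = monad_rules [THEN cmp_eq_cmp]

end

context distributive_law
begin

lemma law_Arr [simp]: "x \<in> Obj C \<Longrightarrow> \<delta> x \<in> Arr C"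
  and src_law [simp]: "x \<in> Obj C \<Longrightarrow> src C (\<delta> x) = omap T (omap S x)"
  and tgt_law [simp]: "x \<in> Obj C \<Longrightarrow> tgt C (\<delta> x) = omap S (omap T x)"
  using nat_trans.component_hom[OF nat] by (auto simp: hom_def comp_functor_def)

lemma law_natural:
  "\<lbrakk>f \<in> Arr C; tgt C f = y\<rbrakk>
    \<Longrightarrow> \<delta> y \<cdot> fmap T (fmap S f) = fmap S (fmap T f) \<cdot> \<delta> (src C f)"
  using nat_trans.naturality[OF nat, of f "src C f" y] by (auto simp: hom_def comp_functor_def)

lemmas law_rules = unit_T unit_S mult_T mult_S law_natural

lemmas rules =
  S.monad_rules S.monad_rules_cmp T.monad_rules T.monad_rules_cmp
  law_rules law_rules [THEN S.cmp_eq_cmp]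

text \<open>Simplification distributes \<open>S\<close> over composites, so it needs the rules also under \<open>S\<close>.\<close>

lemmas S_image_rules =
  T.monad_rules [THEN S.fmap_eq_cmp] T.monad_rules [THEN S.fmap_eq_cmp, THEN S.cmp_eq_cmp]
  law_rules [THEN S.fmap_eq_cmp] law_rules [THEN S.fmap_eq_cmp, THEN S.cmp_eq_cmp]

abbreviation ST where
  "ST \<equiv> composite_monad C S T \<delta>"

lemma composite_sel:
  "omap ST x = omap S (omap T x)"
  "fmap ST f = fmap S (fmap T f)"
  "unit ST x = unit S (omap T x) \<cdot> unit T x"
  "mult ST x = mult S (omap T x) \<cdot> fmap S (fmap S (mult T x)) \<cdot> fmap S (\<delta> (omap T x))"
  by (simp_all add: composite_monad_def comp_functor_def)

lemma endofunctor_composite: "endofunctor C ST"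
  by unfold_locales (auto simp: composite_sel hom_def)

lemma monad_composite: "monad C ST"
proof (intro monad.intro monad_axioms.intro S.category_axioms)
  show "nat_trans C id_functor ST (unit ST)"
    by (rule nat_transI[OF S.endofunctor_id_functor endofunctor_composite])
      (simp_all add: id_functor_def composite_sel rules S_image_rules)
  show "nat_trans C (ST \<odot> ST) ST (mult ST)"
    by (rule nat_transI[OF endofunctor_comp_functor[OF endofunctor_composite endofunctor_composite]
          endofunctor_composite])
      (simp_all add: comp_functor_def composite_sel rules S_image_rules)
\<comment> \<open>What remains are the monad laws of \<open>ST\<close>. The left unit law rests on
  \<open>unit_T\<close> and the right one on \<open>unit_S\<close>. In associativity, \<delta> meets
  the multiplication of \<open>T\<close> on one side and that of \<open>S\<close> on the other,
  whence \<open>mult_T\<close> and \<open>mult_S\<close>.\<close>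
qed (simp_all add: composite_sel rules S_image_rules)

lemma monad_morphism_whisker_unit: "monad_morphism C S ST (whisker_left S (unit T))"
proof (intro monad_morphism.intro monad_morphism_axioms.intro S.monad_axioms monad_composite)
  show "nat_trans C S ST (whisker_left S (unit T))"
    by (rule nat_transI[OF S.endofunctor_axioms endofunctor_composite])
      (simp_all add: whisker_left_def composite_sel rules S_image_rules)
\<comment> \<open>Units agree by naturality of \<open>unit S\<close>. For multiplications,
  \<open>unit_T\<close> absorbs \<delta>, and then a unit law of \<open>T\<close> cancels
  \<open>mult T\<close>.\<close>
qed (simp_all add: whisker_left_def composite_sel rules S_image_rules)

end

theorem proposition2p7:
  fixes C :: "('o, 'a) cat_data"
    and S T :: "('o, 'a) monad_data"
    and \<delta> :: "'o \<Rightarrow> 'a"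
    and z :: 'o
  assumes "category C"
    and "initial_object C z"
    and "monad C S"
    and "monad C T"
    and "distributive_law C S T \<delta>"
    and "constant_free C z T"
  shows "admissible C z S (composite_monad C S T \<delta>) (whisker_left S (unit T))"
proof -
  interpret distributive_law C S T \<delta> by fact
  show ?thesis
    using assms monad_morphism_whisker_unit S.isomorphism_fmap
    by (simp add: admissible_def constant_free_def whisker_left_def)
qed

end
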